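(* Suppose that $P[W=0]=0$ and that $E[W^q]<+\infty$ for every real $q$. Let $m$ be the Mandelbrot cascade associated to the weight $W$ and $Y_\infty=m([0,1])$. Then, for any $\alpha>0$, $E\left[Y_\infty^{-\alpha}\right]<+\infty$.
   Context: Let $\ell\ge 2$ be an integer. For $n\ge 1$ let $\mathcal{M}_n$ be the set of words $\varepsilon=\varepsilon_1\cdots\varepsilon_n$ of length $n$ with letters in $\{0,\dots,\ell-1\}$, let $\mathcal{M}=\bigcup_{n\ge 1}\mathcal{M}_n$, and let $I_{\varepsilon_1\cdots\varepsilon_n}=\left[\sum_{k=1}^n\frac{\varepsilon_k}{\ell^k},\ \sum_{k=1}^n\frac{\varepsilon_k}{\ell^k}+\frac1{\ell^n}\right)$. Let $W$ be a non-negative random variable with $E[W]=1$, and let $(W_\varepsilon)_{\varepsilon\in\mathcal{M}}$ be independent copies of $W$. Let $\lambda$ be the Lebesgue measure on $[0,1]$ and $m_n=f_n\lambda$ with $f_n=\sum_{\varepsilon_1\cdots\varepsilon_n\in\mathcal{M}_n}W_{\varepsilon_1}W_{\varepsilon_1\varepsilon_2}\cdots W_{\varepsilon_1\cdots\varepsilon_n}\mathbf 1_{I_{\varepsilon_1\cdots\varepsilon_n}}$. Almost surely $(m_n)$ converges weakly (against continuous functions on $[0,1]$) to a finite random Borel measure $m$ on $[0,1]$, called the Mandelbrot cascade associated to the weight $W$.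
   Formalization: The formal statement adds the assumption that m is not almost surely the zero measure; without it the claim fails, e.g. for log-normal W = exp(σN − σ²/2) with σ²/2 ≥ log ℓ, where m = 0 almost surely and the negative moments are infinite. *)

theory Defs
  imports "HOL-Probability.Probability"
begin

(* Real powers of non-negative reals with values in [0, \<infinity>].  Unlike powr, which has
   0 powr q = 0 for every q, this uses 0^q = \<infinity> for q < 0 and 0^0 = 1. *)
definition epow :: "real \<Rightarrow> real \<Rightarrow> ennreal" where
  "epow x q = (if x = 0 then (if q < 0 then \<infinity> else if q = 0 then 1 else 0) else ennreal (x powr q))"

definition words_of_length :: "nat \<Rightarrow> nat \<Rightarrow> nat list set" where
  "words_of_length l n = {e. length e = n \<and> set e \<subseteq> {..<l}}"

definition words :: "nat \<Rightarrow> nat list set" where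
  "words l = (\<Union>n\<in>{1..}. words_of_length l n)"

(* The k-th letter (k = 1, 2, ...) of the word e is e ! (k - 1). *)
definition adic_left :: "nat \<Rightarrow> nat list \<Rightarrow> real" where
  "adic_left l e = (\<Sum>k=1..length e. real (e ! (k - 1)) / real l ^ k)"

definition adic_interval :: "nat \<Rightarrow> nat list \<Rightarrow> real set" where
  "adic_interval l e = {adic_left l e ..< adic_left l e + 1 / real l ^ length e}"

definition independent_copies ::
  "'b measure \<Rightarrow> ('b \<Rightarrow> real) \<Rightarrow> 'a measure \<Rightarrow> 'i set \<Rightarrow> ('i \<Rightarrow> 'a \<Rightarrow> real) \<Rightarrow> bool" where
  "independent_copies P W M J X \<longleftrightarrow>
     prob_space.indep_vars M (\<lambda>_. borel) X J \<and>
     (\<forall>j\<in>J. distr M borel (X j) = distr P borel W)"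

definition cascade_density ::
  "nat \<Rightarrow> (nat list \<Rightarrow> 'a \<Rightarrow> real) \<Rightarrow> nat \<Rightarrow> 'a \<Rightarrow> real \<Rightarrow> real" where
  "cascade_density l X n \<omega> x =
     (\<Sum>e\<in>words_of_length l n. (\<Prod>k=1..n. X (take k e) \<omega>) * indicator (adic_interval l e) x)"

definition cascade_approx ::
  "nat \<Rightarrow> (nat list \<Rightarrow> 'a \<Rightarrow> real) \<Rightarrow> nat \<Rightarrow> 'a \<Rightarrow> real measure" where
  "cascade_approx l X n \<omega> =
     density (restrict_space lborel {0..1}) (\<lambda>x. ennreal (cascade_density l X n \<omega> x))"

definition finite_random_measure :: "'a measure \<Rightarrow> ('a \<Rightarrow> real measure) \<Rightarrow> bool" where
  "finite_random_measure M m \<longleftrightarrow>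
     (\<forall>\<omega>\<in>space M. sets (m \<omega>) = sets (restrict_space borel {0..1}) \<and> finite_measure (m \<omega>)) \<and>
     (\<forall>A\<in>sets (restrict_space borel {0..1}). (\<lambda>\<omega>. emeasure (m \<omega>) A) \<in> borel_measurable M)"

(* The measures need not have equal total mass, so the library's weak_conv_m, which compares
   distribution functions of probability measures, does not apply. *)
definition weakly_converges :: "(nat \<Rightarrow> real measure) \<Rightarrow> real measure \<Rightarrow> bool" where
  "weakly_converges \<mu> \<nu> \<longleftrightarrow>
     (\<forall>g::real \<Rightarrow> real. continuous_on {0..1} g \<longrightarrow>
        (\<lambda>n. \<integral>x. g x \<partial>\<mu> n) \<longlonglongrightarrow> (\<integral>x. g x \<partial>\<nu>))"

(* The cascade is an almost sure limit, so it is determined by the weights X only up to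
   modification on a null set; this predicate holds for each of its versions. *)
definition mandelbrot_cascade ::
  "nat \<Rightarrow> 'a measure \<Rightarrow> (nat list \<Rightarrow> 'a \<Rightarrow> real) \<Rightarrow> ('a \<Rightarrow> real measure) \<Rightarrow> bool" where
  "mandelbrot_cascade l M X m \<longleftrightarrow>
     finite_random_measure M m \<and>
     (AE \<omega> in M. weakly_converges (\<lambda>n. cascade_approx l X n \<omega>) (m \<omega>))"

definition total_mass :: "('a \<Rightarrow> real measure) \<Rightarrow> 'a \<Rightarrow> real" where
  "total_mass m \<omega> = measure (m \<omega>) {0..1}"

(* If E[W log W] \<ge> log l, then m = 0 almost surely and the negative moments of its total mass
   are infinite; their finiteness is meaningful only for a non-degenerate cascade. *)
definition nondegenerate :: "'a measure \<Rightarrow> ('a \<Rightarrow> real measure) \<Rightarrow> bool" where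
  "nondegenerate M m \<longleftrightarrow> \<not> (AE \<omega> in M. total_mass m \<omega> = 0)"

end

theory Submission
  imports Defs
begin

text \<open>
  The total mass \<open>Y\<close> of the cascade satisfies a smoothing inequality.  Splitting the tree at its root
  shows \<open>Y \<ge> A\<^sub>0 Y\<^sub>0\<close> and \<open>Y \<ge> A\<^sub>1 Y\<^sub>1\<close>, where \<open>A\<^sub>j\<close> is the weight of the \<open>j\<close>-th child of the root
  divided by \<open>l\<close>, where \<open>Y\<^sub>0\<close> and \<open>Y\<^sub>1\<close> have the law of \<open>Y\<close>, and where all four variables are
  independent.  Two children suffice.

  First, \<open>P(Y = 0) \<le> P(Y = 0)\<^sup>2\<close>, so non-degeneracy gives \<open>Y > 0\<close> almost surely
  (\<open>smoothing_inequality_no_atom_at_zero\<close>).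

  Next, truncate from below by \<open>d > 0\<close> and put \<open>\<mu> = E (max Y d)\<^sup>-\<^sup>\<alpha>\<close> and \<open>h = E (max Y d)\<^sup>-\<^sup>\<alpha>\<^sup>/\<^sup>2\<close>.
  Multiplying the two lower bounds for \<open>Y\<close> gives \<open>\<mu> \<le> c h\<^sup>2\<close> with \<open>c\<close> independent of \<open>d\<close>
  (\<open>regularised_moment_contraction\<close>).  Conversely, Cauchy-Schwarz on the event \<open>Y \<le> y\<close> gives
  \<open>h \<le> y\<^sup>-\<^sup>\<alpha>\<^sup>/\<^sup>2 + sqrt (\<mu> P(Y \<le> y))\<close> (\<open>half_moment_bound\<close>).  As \<open>P(Y \<le> y)\<close> tends to \<open>0\<close> with
  \<open>y\<close>, a small fixed \<open>y\<close> makes the combined inequality contracting in \<open>\<mu>\<close>, and \<open>\<mu>\<close> is bounded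
  uniformly in \<open>d\<close>.  Letting \<open>d\<close> tend to \<open>0\<close> yields the moment of order \<open>- \<alpha>\<close>.  The
  argument treats every \<open>\<alpha>\<close> directly, with neither Laplace transforms nor a bootstrap from small
  exponents.

  To obtain the smoothing inequality, the total mass is written almost surely as a measurable
  function \<open>tree_limit\<close> of the weights.  The weights at and below the first two children form
  disjoint families, which gives independence (\<open>indep_vars_root_part\<close>), and the weights of each
  subtree have the same joint law as all weights (\<open>distr_tree_limit_subtree\<close>).
\<close>

section \<open>Negative moments from a smoothing inequality\<close>

context prob_space begin

text \<open>
  If \<open>Y\<close> vanishes, so do both independent copies, because their weights are positive.  Hence
  \<open>p = P(Y = 0)\<close> satisfies \<open>p \<le> p\<^sup>2\<close>, and \<open>p\<close> is \<open>0\<close> or \<open>1\<close>.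
\<close>

lemma smoothing_inequality_no_atom_at_zero:
  fixes V :: "nat \<Rightarrow> 'a \<Rightarrow> real" and Y :: "'a \<Rightarrow> real"
  assumes indep: "indep_vars (\<lambda>_. borel) V {..<4}"
    and copies: "\<And>i. i \<in> {2, 3} \<Longrightarrow> distr M borel (V i) = distr M borel Y"
    and Y[measurable]: "Y \<in> borel_measurable M"
    and pos: "AE \<omega> in M. 0 < V 0 \<omega> \<and> 0 < V 1 \<omega>"
    and nonneg: "AE \<omega> in M. 0 \<le> Y \<omega>"
    and split: "AE \<omega> in M. V 0 \<omega> * V 2 \<omega> \<le> Y \<omega> \<and> V 1 \<omega> * V 3 \<omega> \<le> Y \<omega>"
    and nonzero: "\<not> (AE \<omega> in M. Y \<omega> = 0)"
  shows "prob {\<omega> \<in> space M. Y \<omega> \<le> 0} = 0"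
proof -
  have V[measurable]: "V i \<in> borel_measurable M" if "i < 4" for i
    using indep that by (auto simp: indep_vars_def)
  define p where "p = prob {\<omega> \<in> space M. Y \<omega> \<le> 0}"
  have copy_p: "prob (V i -` {..0} \<inter> space M) = p" if "i \<in> {2, 3}" for i
  proof -
    have "prob (V i -` {..0} \<inter> space M) = measure (distr M borel (V i)) {..0}"
      using that by (intro measure_distr[symmetric]) auto
    also have "\<dots> = measure (distr M borel Y) {..0}" using copies[OF that] by simp
    also have "\<dots> = p" unfolding p_def by (subst measure_distr) (auto intro!: arg_cong[where f=prob])
    finally show ?thesis .
  qed
  have "p \<le> prob (\<Inter>i\<in>{2,3}. V i -` {..0} \<inter> space M)"
    unfolding p_def
  proof (rule finite_measure_mono_AE)
    show "AE \<omega> in M. \<omega> \<in> {\<omega> \<in> space M. Y \<omega> \<le> 0} \<longrightarrow> \<omega> \<in> (\<Inter>i\<in>{2,3}. V i -` {..0} \<inter> space M)"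
      using pos nonneg split
    proof eventually_elim
      case (elim \<omega>)
      then show ?case by (auto simp: mult_le_0_iff dest!: order_trans[of _ "Y \<omega>" 0])
    qed
  qed auto
  also have "\<dots> = (\<Prod>i\<in>{2,3}. prob (V i -` {..0} \<inter> space M))"
    by (rule indep_varsD[OF indep]) auto
  also have "\<dots> = p * p" by (simp add: copy_p)
  finally have "p \<le> p * p" .
  moreover have "p \<noteq> 1"
  proof
    assume "p = 1"
    then have "AE \<omega> in M. \<omega> \<in> {\<omega> \<in> space M. Y \<omega> \<le> 0}"
      unfolding p_def by (subst prob_eq_1[symmetric]) auto
    with nonneg have "AE \<omega> in M. Y \<omega> = 0" by eventually_elim auto
    with nonzero show False by simp
  qed
  moreover have "0 \<le> p" "p \<le> 1" unfolding p_def by auto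
  ultimately show ?thesis unfolding p_def[symmetric]
    by (metis antisym_conv2 less_eq_real_def mult_le_cancel_left1 not_le)
qed

text \<open>
  Each of the two bounds \<open>Y \<ge> w y\<close> survives the truncation in the form
  \<open>max Y d \<ge> min 1 w \<cdot> max y d\<close>.  Raising to the power \<open>-b\<close>, multiplying the two bounds and using
  independence turns one moment of order \<open>-2b\<close> into the square of a moment of order \<open>-b\<close>.
  The truncation makes every moment of \<open>Y\<close> finite, and the constant in front does not
  depend on \<open>d\<close>.
\<close>

lemma regularised_moment_contraction:
  fixes V :: "nat \<Rightarrow> 'a \<Rightarrow> real" and Y :: "'a \<Rightarrow> real"
  assumes indep: "indep_vars (\<lambda>_. borel) V {..<4}"
    and copies: "\<And>i. i \<in> {2, 3} \<Longrightarrow> distr M borel (V i) = distr M borel Y"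
    and Y[measurable]: "Y \<in> borel_measurable M"
    and pos: "AE \<omega> in M. 0 < V 0 \<omega> \<and> 0 < V 1 \<omega>"
    and split: "AE \<omega> in M. V 0 \<omega> * V 2 \<omega> \<le> Y \<omega> \<and> V 1 \<omega> * V 3 \<omega> \<le> Y \<omega>"
    and moment: "\<And>i. i < 2 \<Longrightarrow> integrable M (\<lambda>\<omega>. V i \<omega> powr - b)"
    and "b > 0" "d > 0"
  shows "expectation (\<lambda>\<omega>. max (Y \<omega>) d powr - (2 * b)) \<le>
      expectation (\<lambda>\<omega>. min 1 (V 0 \<omega>) powr - b) * expectation (\<lambda>\<omega>. min 1 (V 1 \<omega>) powr - b) *
      (expectation (\<lambda>\<omega>. max (Y \<omega>) d powr - b))\<^sup>2"
proof -
  have V[measurable]: "V i \<in> borel_measurable M" if "i < 4" for i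
    using indep that by (auto simp: indep_vars_def)
  define F :: "nat \<Rightarrow> real \<Rightarrow> real" where
    "F i x = (if i < 2 then min 1 x powr - b else max x d powr - b)" for i x
  have F_measurable[measurable]: "F i \<in> borel_measurable borel" for i
    unfolding F_def by measurable
  have F_int: "integrable M (\<lambda>\<omega>. F i (V i \<omega>))" if "i < 4" for i
  proof (cases "i < 2")
    case True
    have [measurable]: "V i \<in> borel_measurable M" using that by (rule V)
    have "integrable M (\<lambda>\<omega>. 1 + V i \<omega> powr - b)"
      by (intro Bochner_Integration.integrable_add integrable_const moment[OF True])
    moreover have "(\<lambda>\<omega>. min 1 (V i \<omega>) powr - b) \<in> borel_measurable M" by measurable
    moreover have "AE \<omega> in M. norm (min 1 (V i \<omega>) powr - b) \<le> norm (1 + V i \<omega> powr - b)"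
      by (auto simp: min_def)
    ultimately have "integrable M (\<lambda>\<omega>. min 1 (V i \<omega>) powr - b)"
      by (rule Bochner_Integration.integrable_bound)
    then show ?thesis using True by (simp add: F_def)
  next
    case False
    have [measurable]: "V i \<in> borel_measurable M" using that by (rule V)
    have "integrable M (\<lambda>\<omega>. max (V i \<omega>) d powr - b)"
      using \<open>b > 0\<close> \<open>d > 0\<close>
      by (intro integrable_const_bound[where B = "d powr - b"]) (auto intro!: powr_mono2')
    then show ?thesis using False by (simp add: F_def)
  qed
  have indepF: "indep_vars (\<lambda>_. borel) (\<lambda>i \<omega>. F i (V i \<omega>)) {..<4}"
    by (rule indep_vars_compose2[OF indep]) auto
  have prodF: "(\<Prod>i<4. F i (V i \<omega>)) = F 0 (V 0 \<omega>) * F 1 (V 1 \<omega>) * F 2 (V 2 \<omega>) * F 3 (V 3 \<omega>)" for \<omega>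
    by (simp add: eval_nat_numeral)
  have copyF: "expectation (\<lambda>\<omega>. F i (V i \<omega>)) = expectation (\<lambda>\<omega>. max (Y \<omega>) d powr - b)"
    if "i \<in> {2, 3}" for i
  proof -
    have "expectation (\<lambda>\<omega>. F i (V i \<omega>)) = integral\<^sup>L (distr M borel (V i)) (F i)"
      using that by (intro integral_distr[symmetric]) auto
    also have "\<dots> = integral\<^sup>L (distr M borel Y) (F i)" using copies[OF that] by simp
    also have "\<dots> = expectation (\<lambda>\<omega>. F i (Y \<omega>))" by (intro integral_distr) auto
    finally show ?thesis using that by (auto simp: F_def)
  qed
  have "expectation (\<lambda>\<omega>. max (Y \<omega>) d powr - (2 * b)) \<le> expectation (\<lambda>\<omega>. \<Prod>i<4. F i (V i \<omega>))"
  proof (rule integral_mono_AE)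
    show "integrable M (\<lambda>\<omega>. max (Y \<omega>) d powr - (2 * b))"
      using \<open>b > 0\<close> \<open>d > 0\<close>
      by (intro integrable_const_bound[where B = "d powr - (2 * b)"]) (auto intro!: powr_mono2')
    show "integrable M (\<lambda>\<omega>. \<Prod>i<4. F i (V i \<omega>))"
      by (rule indep_vars_integrable) (use indepF F_int in auto)
    show "AE \<omega> in M. max (Y \<omega>) d powr - (2 * b) \<le> (\<Prod>i<4. F i (V i \<omega>))"
      using pos split
    proof eventually_elim
      case (elim \<omega>)
      have half: "max (Y \<omega>) d powr - b \<le> min 1 w powr - b * max y d powr - b"
        if "0 < w" "w * y \<le> Y \<omega>" for w y
      proof -
        have "min 1 w * max y d \<le> max (Y \<omega>) d"
        proof (cases "y \<le> d")
          case True
          then have "min 1 w * max y d = min 1 w * d" by (simp add: max_def)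
          also have "\<dots> \<le> 1 * d" using \<open>d > 0\<close> by (intro mult_right_mono) auto
          finally show ?thesis by simp
        next
          case False
          then have "min 1 w * max y d = min 1 w * y" by (simp add: max_def)
          also have "\<dots> \<le> w * y" using False \<open>d > 0\<close> by (intro mult_right_mono) auto
          finally show ?thesis using that by simp
        qed
        moreover have "0 < min 1 w * max y d" using that \<open>d > 0\<close> by auto
        ultimately have "max (Y \<omega>) d powr - b \<le> (min 1 w * max y d) powr - b"
          using \<open>b > 0\<close> by (intro powr_mono2') auto
        then show ?thesis using that \<open>d > 0\<close> by (simp add: powr_mult)
      qed
      have "max (Y \<omega>) d powr - (2 * b) = max (Y \<omega>) d powr - b * max (Y \<omega>) d powr - b"
        by (simp add: powr_add[symmetric])
      also have "\<dots> \<le> (min 1 (V 0 \<omega>) powr - b * max (V 2 \<omega>) d powr - b) *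
          (min 1 (V 1 \<omega>) powr - b * max (V 3 \<omega>) d powr - b)"
        using elim by (intro mult_mono half) auto
      finally show ?case unfolding prodF by (simp add: F_def mult_ac)
    qed
  qed
  also have "\<dots> = (\<Prod>i<4. expectation (\<lambda>\<omega>. F i (V i \<omega>)))"
    by (rule indep_vars_lebesgue_integral) (use indepF F_int in auto)
  also have "\<dots> = expectation (\<lambda>\<omega>. F 0 (V 0 \<omega>)) * expectation (\<lambda>\<omega>. F 1 (V 1 \<omega>)) *
      expectation (\<lambda>\<omega>. F 2 (V 2 \<omega>)) * expectation (\<lambda>\<omega>. F 3 (V 3 \<omega>))"
    by (simp add: eval_nat_numeral)
  finally show ?thesis by (simp add: copyF power2_eq_square mult.assoc) (simp add: F_def)
qed

lemma ex_threshold_with_small_prob: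
  fixes Y :: "'a \<Rightarrow> real"
  assumes Y[measurable]: "Y \<in> borel_measurable M"
    and zero: "prob {\<omega> \<in> space M. Y \<omega> \<le> 0} = 0" and "e > 0"
  shows "\<exists>y>0. prob {\<omega> \<in> space M. Y \<omega> \<le> y} < e"
proof -
  define A where "A n = {\<omega> \<in> space M. Y \<omega> \<le> 1 / real (Suc n)}" for n
  have "(\<lambda>n. prob (A n)) \<longlonglongrightarrow> prob (\<Inter>n. A n)"
  proof (rule finite_Lim_measure_decseq)
    show "range A \<subseteq> events" unfolding A_def by auto
    show "decseq A"
      unfolding decseq_def A_def by (auto elim!: order_trans intro!: divide_left_mono)
  qed
  also have "(\<Inter>n. A n) = {\<omega> \<in> space M. Y \<omega> \<le> 0}"
  proof -
    have "y \<le> 0" if "\<And>n. y \<le> 1 / real (Suc n)" for y :: real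
      using that LIMSEQ_inverse_real_of_nat
      by (intro LIMSEQ_le_const[of "\<lambda>n. inverse (real (Suc n))"]) (auto simp: inverse_eq_divide)
    then show ?thesis 
      by (auto simp: A_def intro: order_trans[of _ 0])
  qed
  finally have "(\<lambda>n. prob (A n)) \<longlonglongrightarrow> 0" using zero by simp
  then have "eventually (\<lambda>n. prob (A n) < e) sequentially"
    using \<open>e > 0\<close> by (rule order_tendstoD)
  then obtain n where "prob (A n) < e" by (auto simp: eventually_sequentially)
  then show ?thesis unfolding A_def by (intro exI[of _ "1 / real (Suc n)"]) auto
qed

text \<open>
  The reverse comparison.  Where \<open>Y > y\<close> the integrand is at most \<open>y powr - b\<close>; on the small event
  \<open>Y \<le> y\<close> this is the Cauchy-Schwarz inequality for the integrand and the indicator of the event,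
  obtained from the inequality \<open>u \<le> \<theta> u\<^sup>2 / 2 + 1 / (2 \<theta>)\<close> with the best choice of \<open>\<theta>\<close>.
\<close>

lemma half_moment_bound:
  fixes Y :: "'a \<Rightarrow> real"
  assumes Y[measurable]: "Y \<in> borel_measurable M" and "b > 0" "d > 0" "y > 0"
    and "\<eta> > 0" and small: "prob {\<omega> \<in> space M. Y \<omega> \<le> y} \<le> \<eta>\<^sup>2"
  shows "expectation (\<lambda>\<omega>. max (Y \<omega>) d powr - b) \<le>
      y powr - b + \<eta> * sqrt (expectation (\<lambda>\<omega>. max (Y \<omega>) d powr - (2 * b)))"
proof -
  define U where "U \<omega> = max (Y \<omega>) d powr - b" for \<omega>
  define A where "A = {\<omega> \<in> space M. Y \<omega> \<le> y}"
  have A[measurable]: "A \<in> events" unfolding A_def by measurable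
  have U_sq: "max (Y \<omega>) d powr - (2 * b) = (U \<omega>)\<^sup>2" for \<omega>
    unfolding U_def by (simp add: power2_eq_square powr_add[symmetric])
  define mm where "mm = expectation (\<lambda>\<omega>. (U \<omega>)\<^sup>2)"
  have Um[measurable]: "U \<in> borel_measurable M" unfolding U_def by measurable
  have U_pos: "0 < U \<omega>" for \<omega> using \<open>d > 0\<close> unfolding U_def by simp
  have U_int: "integrable M U" unfolding U_def
    using \<open>b > 0\<close> \<open>d > 0\<close>
    by (intro integrable_const_bound[where B = "d powr - b"]) (auto intro!: powr_mono2')
  have U2_int: "integrable M (\<lambda>\<omega>. (U \<omega>)\<^sup>2)" unfolding U_sq[symmetric]
    using \<open>b > 0\<close> \<open>d > 0\<close>
    by (intro integrable_const_bound[where B = "d powr - (2 * b)"]) (auto intro!: powr_mono2')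
  have "mm > 0"
  proof -
    have "mm \<noteq> 0"
    proof
      assume "mm = 0"
      then have "AE \<omega> in M. (U \<omega>)\<^sup>2 = 0"
        unfolding mm_def using U2_int by (subst (asm) integral_nonneg_eq_0_iff_AE) auto
      then have "AE \<omega> in M. False"
      proof eventually_elim
        case (elim \<omega>)
        with U_pos[of \<omega>] show ?case by simp
      qed
      then show False by simp
    qed
    moreover have "mm \<ge> 0" unfolding mm_def by simp
    ultimately show ?thesis by simp
  qed
  \<comment> \<open>Minimises \<open>\<theta> / 2 * mm + \<eta>\<^sup>2 / (2 * \<theta>)\<close>.\<close>
  define \<theta> where "\<theta> = \<eta> / sqrt mm"
  have "\<theta> > 0" using \<open>mm > 0\<close> \<open>\<eta> > 0\<close> by (simp add: \<theta>_def)
  have pointwise: "U \<omega> \<le> y powr - b + \<theta> / 2 * (U \<omega>)\<^sup>2 + 1 / (2 * \<theta>) * indicator A \<omega>"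
    if "\<omega> \<in> space M" for \<omega>
  proof (cases "\<omega> \<in> A")
    case True
    have "0 \<le> (\<theta> * U \<omega> - 1)\<^sup>2 / (2 * \<theta>)" using \<open>\<theta> > 0\<close> by simp
    also have "\<dots> = \<theta> / 2 * (U \<omega>)\<^sup>2 + 1 / (2 * \<theta>) - U \<omega>"
      using \<open>\<theta> > 0\<close> by (simp add: field_simps power2_eq_square)
    finally have "U \<omega> \<le> \<theta> / 2 * (U \<omega>)\<^sup>2 + 1 / (2 * \<theta>)" by simp
    moreover have "0 \<le> y powr - b" by simp
    ultimately have "U \<omega> \<le> y powr - b + \<theta> / 2 * (U \<omega>)\<^sup>2 + 1 / (2 * \<theta>)" by linarith
    then show ?thesis using True by simp
  next
    case False
    then have "y < Y \<omega>" using that by (auto simp: A_def)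
    then have "U \<omega> \<le> y powr - b"
      unfolding U_def using \<open>b > 0\<close> \<open>y > 0\<close> by (intro powr_mono2') auto
    then show ?thesis using False \<open>\<theta> > 0\<close> by (simp add: add_increasing2)
  qed
  have "expectation U \<le> expectation
      (\<lambda>\<omega>. y powr - b + \<theta> / 2 * (U \<omega>)\<^sup>2 + 1 / (2 * \<theta>) * indicator A \<omega>)"
    using pointwise U_int U2_int by (intro integral_mono) (auto simp: emeasure_eq_measure)
  also have "\<dots> = y powr - b + \<theta> / 2 * mm + 1 / (2 * \<theta>) * prob A"
    using U2_int by (simp add: mm_def prob_space emeasure_eq_measure)
  also have "\<dots> \<le> y powr - b + \<theta> / 2 * mm + 1 / (2 * \<theta>) * \<eta>\<^sup>2"
    using small \<open>\<theta> > 0\<close> by (intro add_left_mono mult_left_mono) (auto simp: A_def)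
  also have "\<dots> = y powr - b + \<eta> * sqrt mm"
  proof -
    have "mm / sqrt mm = sqrt mm" using \<open>mm > 0\<close> by (simp add: real_div_sqrt)
    then show ?thesis using \<open>mm > 0\<close> \<open>\<eta> > 0\<close>
      by (simp add: \<theta>_def power2_eq_square field_simps)
  qed
  finally show ?thesis unfolding U_sq mm_def[symmetric] U_def[symmetric] by simp
qed

text \<open>
  Write \<open>\<mu>\<close> for the truncated moment.  The two comparisons give
  \<open>\<mu> \<le> c (y powr - b + \<eta> sqrt \<mu>)\<^sup>2 \<le> 2 c (y powr - b)\<^sup>2 + 2 c \<eta>\<^sup>2 \<mu>\<close>.
  Since \<open>Y\<close> has no atom at \<open>0\<close>, the level \<open>y\<close> can be chosen so low that \<open>\<eta>\<close> makes the last
  coefficient at most \<open>1/2\<close>.  As \<open>\<mu>\<close> is finite, this term can be absorbed on the left, and what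
  remains does not depend on \<open>d\<close>.
\<close>

lemma regularised_moments_bounded:
  fixes V :: "nat \<Rightarrow> 'a \<Rightarrow> real" and Y :: "'a \<Rightarrow> real"
  assumes indep: "indep_vars (\<lambda>_. borel) V {..<4}"
    and copies: "\<And>i. i \<in> {2, 3} \<Longrightarrow> distr M borel (V i) = distr M borel Y"
    and Y[measurable]: "Y \<in> borel_measurable M"
    and pos: "AE \<omega> in M. 0 < V 0 \<omega> \<and> 0 < V 1 \<omega>"
    and split: "AE \<omega> in M. V 0 \<omega> * V 2 \<omega> \<le> Y \<omega> \<and> V 1 \<omega> * V 3 \<omega> \<le> Y \<omega>"
    and moment: "\<And>i. i < 2 \<Longrightarrow> integrable M (\<lambda>\<omega>. V i \<omega> powr - b)"
    and zero: "prob {\<omega> \<in> space M. Y \<omega> \<le> 0} = 0"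
    and "b > 0"
  shows "\<exists>K. \<forall>d>0. expectation (\<lambda>\<omega>. max (Y \<omega>) d powr - (2 * b)) \<le> K"
proof -
  define c where
    "c = expectation (\<lambda>\<omega>. min 1 (V 0 \<omega>) powr - b) * expectation (\<lambda>\<omega>. min 1 (V 1 \<omega>) powr - b)"
  have "c \<ge> 0" unfolding c_def by simp
  \<comment> \<open>Chosen so that \<open>2 c \<eta>\<^sup>2 \<le> 1/2\<close>; the summand 1 covers the case \<open>c = 0\<close>.\<close>
  define \<eta> where "\<eta> = 1 / (2 * sqrt (c + 1))"
  have "\<eta> > 0" using \<open>c \<ge> 0\<close> by (simp add: \<eta>_def)
  have \<eta>_sq: "\<eta>\<^sup>2 = 1 / (4 * (c + 1))" using \<open>c \<ge> 0\<close> by (simp add: \<eta>_def power_divide power_mult_distrib)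
  obtain y where "y > 0" and y: "prob {\<omega> \<in> space M. Y \<omega> \<le> y} < \<eta>\<^sup>2"
    using ex_threshold_with_small_prob[OF Y zero, of "\<eta>\<^sup>2"] \<open>\<eta> > 0\<close> by auto
  have "expectation (\<lambda>\<omega>. max (Y \<omega>) d powr - (2 * b)) \<le> 4 * c * (y powr - b)\<^sup>2" if "d > 0" for d
  proof -
    define mm where "mm = expectation (\<lambda>\<omega>. max (Y \<omega>) d powr - (2 * b))"
    define h where "h = expectation (\<lambda>\<omega>. max (Y \<omega>) d powr - b)"
    have "mm \<ge> 0" "h \<ge> 0" unfolding mm_def h_def by auto
    have "mm \<le> c * h\<^sup>2" unfolding mm_def c_def h_def
      using indep copies Y pos split moment \<open>b > 0\<close> that by (rule regularised_moment_contraction)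
    also have "h \<le> y powr - b + \<eta> * sqrt mm" unfolding mm_def h_def
      using Y \<open>b > 0\<close> that \<open>y > 0\<close> \<open>\<eta> > 0\<close> y by (intro half_moment_bound) auto
    then have "c * h\<^sup>2 \<le> c * (y powr - b + \<eta> * sqrt mm)\<^sup>2"
      using \<open>h \<ge> 0\<close> \<open>c \<ge> 0\<close> by (intro mult_left_mono power_mono) auto
    also have "\<dots> \<le> c * (2 * (y powr - b)\<^sup>2 + 2 * (\<eta> * sqrt mm)\<^sup>2)"
      using \<open>c \<ge> 0\<close> sum_squares_bound[of "y powr - b" "\<eta> * sqrt mm"]
      by (intro mult_left_mono) (auto simp: power2_sum)
    also have "\<dots> = 2 * c * (y powr - b)\<^sup>2 + c / (c + 1) * (mm / 2)"
      using \<open>c \<ge> 0\<close> \<open>mm \<ge> 0\<close> by (simp add: power_mult_distrib \<eta>_sq field_simps)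
    also have "c / (c + 1) * (mm / 2) \<le> 1 * (mm / 2)"
      using \<open>c \<ge> 0\<close> \<open>mm \<ge> 0\<close> by (intro mult_right_mono) auto
    finally show ?thesis unfolding mm_def[symmetric] by simp
  qed
  then show ?thesis by blast
qed

text \<open>
  The truncation is removed by Fatou's lemma along \<open>d = 1 / (n + 1)\<close>.
\<close>

lemma negative_moment_of_smoothing_inequality:
  fixes V :: "nat \<Rightarrow> 'a \<Rightarrow> real" and Y :: "'a \<Rightarrow> real"
  assumes indep: "indep_vars (\<lambda>_. borel) V {..<4}"
    and copies: "\<And>i. i \<in> {2, 3} \<Longrightarrow> distr M borel (V i) = distr M borel Y"
    and Y[measurable]: "Y \<in> borel_measurable M"
    and pos: "AE \<omega> in M. 0 < V 0 \<omega> \<and> 0 < V 1 \<omega>"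
    and nonneg: "AE \<omega> in M. 0 \<le> Y \<omega>"
    and split: "AE \<omega> in M. V 0 \<omega> * V 2 \<omega> \<le> Y \<omega> \<and> V 1 \<omega> * V 3 \<omega> \<le> Y \<omega>"
    and moment: "\<And>i. i < 2 \<Longrightarrow> integrable M (\<lambda>\<omega>. V i \<omega> powr - (\<alpha> / 2))"
    and nonzero: "\<not> (AE \<omega> in M. Y \<omega> = 0)"
    and "\<alpha> > 0"
  shows "(\<integral>\<^sup>+ \<omega>. epow (Y \<omega>) (- \<alpha>) \<partial>M) < \<infinity>"
proof -
  have zero: "prob {\<omega> \<in> space M. Y \<omega> \<le> 0} = 0"
    using indep copies Y pos nonneg split nonzero by (rule smoothing_inequality_no_atom_at_zero)
  have "\<exists>K. \<forall>d>0. expectation (\<lambda>\<omega>. max (Y \<omega>) d powr - (2 * (\<alpha> / 2))) \<le> K"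
    using indep copies Y pos split moment zero by (rule regularised_moments_bounded) (use \<open>\<alpha> > 0\<close> in auto)
  then obtain K where K: "expectation (\<lambda>\<omega>. max (Y \<omega>) d powr - \<alpha>) \<le> K" if "d > 0" for d
    by auto
  define U where "U n \<omega> = max (Y \<omega>) (1 / real (Suc n)) powr - \<alpha>" for n \<omega>
  have U_bound: "(\<integral>\<^sup>+ \<omega>. ennreal (U n \<omega>) \<partial>M) \<le> ennreal K" for n
  proof -
    have "integrable M (U n)" unfolding U_def using \<open>\<alpha> > 0\<close>
      by (intro integrable_const_bound[where B = "(1 / real (Suc n)) powr - \<alpha>"])
        (auto intro!: powr_mono2')
    then have "(\<integral>\<^sup>+ \<omega>. ennreal (U n \<omega>) \<partial>M) = ennreal (expectation (U n))"
      by (rule nn_integral_eq_integral) (auto simp: U_def)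
    also have "\<dots> \<le> ennreal K" using K[of "1 / real (Suc n)"] by (intro ennreal_leI) (simp add: U_def[abs_def])
    finally show ?thesis .
  qed
  have "AE \<omega> in M. \<omega> \<notin> {\<omega> \<in> space M. Y \<omega> \<le> 0}"
    using zero by (subst prob_eq_0[symmetric]) auto
  then have "AE \<omega> in M. epow (Y \<omega>) (- \<alpha>) = liminf (\<lambda>n. ennreal (U n \<omega>))"
    using AE_space
  proof eventually_elim
    case (elim \<omega>)
    then have "Y \<omega> > 0" by auto
    have "(\<lambda>n. max (Y \<omega>) (1 / real (Suc n))) \<longlonglongrightarrow> max (Y \<omega>) 0"
      using LIMSEQ_inverse_real_of_nat unfolding inverse_eq_divide
      by (intro tendsto_max tendsto_const)
    then have "(\<lambda>n. U n \<omega>) \<longlonglongrightarrow> max (Y \<omega>) 0 powr - \<alpha>"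
      unfolding U_def using \<open>Y \<omega> > 0\<close> by (intro tendsto_powr[OF _ tendsto_const]) auto
    then have "(\<lambda>n. ennreal (U n \<omega>)) \<longlonglongrightarrow> ennreal (Y \<omega> powr - \<alpha>)"
      using \<open>Y \<omega> > 0\<close> by (intro tendsto_ennrealI) (simp add: max_def)
    then have "liminf (\<lambda>n. ennreal (U n \<omega>)) = ennreal (Y \<omega> powr - \<alpha>)"
      by (intro lim_imp_Liminf) auto
    then show ?case using \<open>Y \<omega> > 0\<close> by (simp add: epow_def)
  qed
  then have "(\<integral>\<^sup>+ \<omega>. epow (Y \<omega>) (- \<alpha>) \<partial>M) = (\<integral>\<^sup>+ \<omega>. liminf (\<lambda>n. ennreal (U n \<omega>)) \<partial>M)"
    by (rule nn_integral_cong_AE)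
  also have "\<dots> \<le> liminf (\<lambda>n. \<integral>\<^sup>+ \<omega>. ennreal (U n \<omega>) \<partial>M)"
    by (rule nn_integral_liminf) (simp add: U_def)
  also have "\<dots> \<le> liminf (\<lambda>n. ennreal K)" by (intro Liminf_mono always_eventually allI U_bound)
  also have "\<dots> = ennreal K" by (simp add: Liminf_const)
  also have "\<dots> < \<infinity>" by simp
  finally show ?thesis .
qed

end

section \<open>The limit mass as a function of the weights\<close>

text \<open>
  For non-negative weights this is the mass of the unit interval after \<open>n\<close> generations, as a function
  of the weights alone.  Extended values make its lower limit exist for every family of weights, so
  that the limit mass of a subtree is the same measurable function of the shifted weights.
\<close>

definition tree_mass :: "nat \<Rightarrow> nat \<Rightarrow> (nat list \<Rightarrow> real) \<Rightarrow> ennreal" where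
  "tree_mass l n x =
     ennreal (1 / real l ^ n) * (\<Sum>e\<in>words_of_length l n. \<Prod>k=1..n. ennreal (x (take k e)))"

definition tree_limit :: "nat \<Rightarrow> (nat list \<Rightarrow> real) \<Rightarrow> ennreal" where
  "tree_limit l x = liminf (\<lambda>n. tree_mass l n x)"

lemma finite_words_of_length [simp]: "finite (words_of_length l n)"
  unfolding words_of_length_def using finite_lists_length_eq[of "{..<l}" n] by (simp add: conj_commute)

lemma words_of_length_Suc:
  "words_of_length l (Suc n) = (\<lambda>(j, e). j # e) ` ({..<l} \<times> words_of_length l n)"
  unfolding words_of_length_def by (auto simp: length_Suc_conv image_iff)

lemma take_in_words:
  assumes "e \<in> words_of_length l n" "1 \<le> k" "k \<le> n"
  shows "take k e \<in> words l"
  using assms set_take_subset[of k e] unfolding words_def words_of_length_def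
  by (auto intro!: bexI[of _ k])

lemma singleton_in_words: "j < l \<Longrightarrow> [j] \<in> words l"
  unfolding words_def words_of_length_def by (auto intro!: bexI[of _ 1])

lemma Cons_in_words: "e \<in> words l \<Longrightarrow> j < l \<Longrightarrow> j # e \<in> words l"
  unfolding words_def words_of_length_def by (auto intro!: bexI[of _ "Suc (length e)"])

lemma Nil_notin_words: "[] \<notin> words l"
  unfolding words_def words_of_length_def by auto

lemma tree_mass_cong:
  "(\<And>e. e \<in> words l \<Longrightarrow> x e = y e) \<Longrightarrow> tree_mass l n x = tree_mass l n y"
  unfolding tree_mass_def by (auto intro!: sum.cong prod.cong arg_cong2[where f = "(*)"] simp: take_in_words)

lemma tree_limit_cong:
  "(\<And>e. e \<in> words l \<Longrightarrow> x e = y e) \<Longrightarrow> tree_limit l x = tree_limit l y"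
  unfolding tree_limit_def using tree_mass_cong[of l x y] by simp

lemma measurable_tree_limit [measurable]:
  "tree_limit l \<in> borel_measurable (PiM (words l) (\<lambda>_. borel))"
proof -
  have [measurable]: "(\<lambda>x. x (take k e)) \<in> borel_measurable (PiM (words l) (\<lambda>_. borel))"
    if "e \<in> words_of_length l n" "k \<in> {1..n}" for n k e
    using take_in_words[OF that(1)] that(2) by (intro measurable_component_singleton) auto
  show ?thesis unfolding tree_limit_def[abs_def] tree_mass_def by measurable
qed

text \<open>
  Grouping the words by their first letter splits the tree at its root.
\<close>

lemma tree_mass_Suc:
  "tree_mass l (Suc n) x =
     (\<Sum>j<l. ennreal (1 / real l) * ennreal (x [j]) * tree_mass l n (\<lambda>e. x (j # e)))"
proof -
  have split: "(\<Prod>k=1..Suc n. ennreal (x (take k (j # e)))) =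
      ennreal (x [j]) * (\<Prod>k=1..n. ennreal (x (j # take k e)))" for j e
    by (simp add: prod.atLeast_Suc_atMost prod.shift_bounds_cl_Suc_ivl del: prod.cl_ivl_Suc)
  have "(\<Sum>e\<in>words_of_length l (Suc n). \<Prod>k=1..Suc n. ennreal (x (take k e))) =
      (\<Sum>(j, e)\<in>{..<l} \<times> words_of_length l n. \<Prod>k=1..Suc n. ennreal (x (take k (j # e))))"
    unfolding words_of_length_Suc
    by (subst sum.reindex) (auto simp: inj_on_def case_prod_beta)
  also have "\<dots> = (\<Sum>j<l. \<Sum>e\<in>words_of_length l n.
      ennreal (x [j]) * (\<Prod>k=1..n. ennreal (x (j # take k e))))"
    unfolding split by (rule sum.cartesian_product[symmetric])
  finally have sum: "(\<Sum>e\<in>words_of_length l (Suc n). \<Prod>k=1..Suc n. ennreal (x (take k e))) =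
      (\<Sum>j<l. \<Sum>e\<in>words_of_length l n.
        ennreal (x [j]) * (\<Prod>k=1..n. ennreal (x (j # take k e))))" .
  have "ennreal (1 / real l ^ Suc n) = ennreal (1 / real l) * ennreal (1 / real l ^ n)"
    by (subst ennreal_mult[symmetric]) auto
  then show ?thesis
    unfolding tree_mass_def sum by (simp add: sum_distrib_left mult_ac)
qed

lemma liminf_cmult_le:
  fixes c :: ennreal
  shows "c * liminf f \<le> liminf (\<lambda>n. c * f n)"
  unfolding liminf_SUP_INF SUP_mult_left_ennreal
  by (intro SUP_mono' INF_greatest mult_left_mono INF_lower) auto

text \<open>
  The lower limit need not be additive, but keeping a single summand of the recursion at the root
  gives an inequality in the direction needed for negative moments.
\<close>

lemma tree_limit_ge_subtree:
  assumes "j < l"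
  shows "ennreal (1 / real l) * ennreal (x [j]) * tree_limit l (\<lambda>e. x (j # e)) \<le> tree_limit l x"
proof -
  have "ennreal (1 / real l) * ennreal (x [j]) * tree_limit l (\<lambda>e. x (j # e)) \<le>
      liminf (\<lambda>n. ennreal (1 / real l) * ennreal (x [j]) * tree_mass l n (\<lambda>e. x (j # e)))"
    unfolding tree_limit_def by (rule liminf_cmult_le)
  also have "\<dots> \<le> liminf (\<lambda>n. tree_mass l (Suc n) x)"
    unfolding tree_mass_Suc using assms
    by (intro Liminf_mono always_eventually allI member_le_sum) auto
  also have "\<dots> = tree_limit l x"
    unfolding tree_limit_def using liminf_shift[of "\<lambda>n. tree_mass l n x"] by simp
  finally show ?thesis .
qed

lemma adic_left_Cons:
  "adic_left l (j # e) = real j / real l + adic_left l e / real l"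
proof -
  have "adic_left l (j # e) = (\<Sum>k=1..Suc (length e). real ((j # e) ! (k - 1)) / real l ^ k)"
    by (simp add: adic_left_def)
  also have "\<dots> = real j / real l + (\<Sum>k=1..length e. real ((j # e) ! k) / real l ^ Suc k)"
    by (simp add: sum.atLeast_Suc_atMost sum.shift_bounds_cl_Suc_ivl del: sum.cl_ivl_Suc)
  also have "(\<Sum>k=1..length e. real ((j # e) ! k) / real l ^ Suc k) = adic_left l e / real l"
    unfolding adic_left_def sum_divide_distrib by (intro sum.cong) (auto simp: nth_Cons')
  finally show ?thesis .
qed

lemma adic_interval_subset_unit:
  assumes "l > 0" "set e \<subseteq> {..<l}"
  shows "adic_interval l e \<subseteq> {0..1}"
proof -
  have "0 \<le> adic_left l e \<and> adic_left l e + 1 / real l ^ length e \<le> 1"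
    using assms(2)
  proof (induction e)
    case Nil
    then show ?case by (simp add: adic_left_def)
  next
    case (Cons j e)
    have "real j + (adic_left l e + 1 / real l ^ length e) \<le> real j + 1" using Cons by simp
    also have "real j + 1 \<le> real l" using Cons.prems by auto
    finally have "(real j + (adic_left l e + 1 / real l ^ length e)) / real l \<le> 1"
      using \<open>l > 0\<close> by simp
    then have "adic_left l (j # e) + 1 / real l ^ length (j # e) \<le> 1"
      by (simp add: adic_left_Cons add_divide_distrib mult.commute)
    moreover have "0 \<le> adic_left l (j # e)" using Cons by (simp add: adic_left_Cons)
    ultimately show ?case by simp
  qed
  then show ?thesis unfolding adic_interval_def by auto
qed

text \<open>
  All intervals of generation \<open>n\<close> lie in the unit interval and have length \<open>1 / l ^ n\<close>, hence no mass
  is lost in the restriction to \<open>{0..1}\<close>.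
\<close>

lemma emeasure_cascade_approx:
  assumes "l > 0" and nonneg: "\<And>e. e \<in> words l \<Longrightarrow> 0 \<le> X e \<omega>"
  shows "emeasure (cascade_approx l X n \<omega>) {0..1} = tree_mass l n (\<lambda>e. X e \<omega>)"
proof -
  let ?R = "restrict_space lborel {0..1::real}"
  have I_sets [measurable]: "adic_interval l e \<in> sets borel" for e
    unfolding adic_interval_def by simp
  have I_meas: "(\<lambda>x. indicator (adic_interval l e) x :: real) \<in> borel_measurable ?R" for e
    by (intro measurable_restrict_space1) simp
  have dens: "ennreal (cascade_density l X n \<omega> x) =
      (\<Sum>e\<in>words_of_length l n. (\<Prod>k=1..n. ennreal (X (take k e) \<omega>)) * indicator (adic_interval l e) x)" for x
  proof -
    have prod_nonneg: "0 \<le> (\<Prod>k=1..n. X (take k e) \<omega>)" if "e \<in> words_of_length l n" for e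
      using take_in_words[OF that] nonneg by (intro prod_nonneg) auto
    have "ennreal (cascade_density l X n \<omega> x) =
        (\<Sum>e\<in>words_of_length l n. ennreal ((\<Prod>k=1..n. X (take k e) \<omega>) * indicator (adic_interval l e) x))"
      unfolding cascade_density_def using prod_nonneg by (intro sum_ennreal[symmetric]) auto
    also have "\<dots> = (\<Sum>e\<in>words_of_length l n.
        (\<Prod>k=1..n. ennreal (X (take k e) \<omega>)) * indicator (adic_interval l e) x)"
    proof (intro sum.cong refl)
      fix e assume e: "e \<in> words_of_length l n"
      have "ennreal (\<Prod>k=1..n. X (take k e) \<omega>) = (\<Prod>k=1..n. ennreal (X (take k e) \<omega>))"
        using take_in_words[OF e] nonneg by (intro prod_ennreal[symmetric]) auto
      then show "ennreal ((\<Prod>k=1..n. X (take k e) \<omega>) * indicator (adic_interval l e) x) =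
          (\<Prod>k=1..n. ennreal (X (take k e) \<omega>)) * indicator (adic_interval l e) x"
        using prod_nonneg[OF e] by (simp add: ennreal_mult ennreal_indicator)
    qed
    finally show ?thesis .
  qed
  have dens_meas: "(\<lambda>x. ennreal (cascade_density l X n \<omega> x)) \<in> borel_measurable ?R"
    unfolding cascade_density_def using I_meas by measurable
  have "emeasure (cascade_approx l X n \<omega>) {0..1} =
      (\<integral>\<^sup>+ x. ennreal (cascade_density l X n \<omega> x) * indicator {0..1} x \<partial>?R)"
    unfolding cascade_approx_def using dens_meas
    by (intro emeasure_density) (auto simp: sets_restrict_space)
  also have "\<dots> = (\<integral>\<^sup>+ x. ennreal (cascade_density l X n \<omega> x) * indicator {0..1} x \<partial>lborel)"
    by (subst nn_integral_restrict_space) (auto intro!: nn_integral_cong simp: indicator_def)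
  also have "\<dots> = (\<integral>\<^sup>+ x. (\<Sum>e\<in>words_of_length l n.
        (\<Prod>k=1..n. ennreal (X (take k e) \<omega>)) * indicator (adic_interval l e) x) \<partial>lborel)"
    unfolding dens
  proof (intro nn_integral_cong)
    fix x :: real
    have "indicator (adic_interval l e) x * indicator {0..1} x = (indicator (adic_interval l e) x :: ennreal)"
      if "e \<in> words_of_length l n" for e
      using adic_interval_subset_unit[OF \<open>l > 0\<close>, of e] that
      by (auto simp: indicator_def words_of_length_def)
    then show "(\<Sum>e\<in>words_of_length l n. (\<Prod>k=1..n. ennreal (X (take k e) \<omega>)) *
          indicator (adic_interval l e) x) * indicator {0..1} x =
        (\<Sum>e\<in>words_of_length l n. (\<Prod>k=1..n. ennreal (X (take k e) \<omega>)) * indicator (adic_interval l e) x)"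
      unfolding sum_distrib_right by (intro sum.cong) (auto simp: mult.assoc)
  qed
  also have "\<dots> = (\<Sum>e\<in>words_of_length l n.
      (\<Prod>k=1..n. ennreal (X (take k e) \<omega>)) * emeasure lborel (adic_interval l e))"
    by (subst nn_integral_sum) (auto simp: nn_integral_cmult)
  also have "\<dots> = (\<Sum>e\<in>words_of_length l n.
      (\<Prod>k=1..n. ennreal (X (take k e) \<omega>)) * ennreal (1 / real l ^ n))"
    by (intro sum.cong) (auto simp: adic_interval_def words_of_length_def)
  finally show ?thesis unfolding tree_mass_def by (simp add: sum_distrib_left mult.commute)
qed

lemma tree_mass_finite: "tree_mass l n x < \<top>"
proof -
  have "(\<Prod>k=1..n. ennreal (x (take k e))) < \<top>" for e
    by (rule finite_induct[of "{1..n}"]) (auto simp: ennreal_mult_less_top)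
  then show ?thesis unfolding tree_mass_def by (auto simp: ennreal_mult_less_top)
qed

text \<open>
  Weak convergence is tested against the constant function \<open>1\<close>.
\<close>

lemma tree_limit_eq_total_mass:
  assumes "l > 0" and nonneg: "\<And>e. e \<in> words l \<Longrightarrow> 0 \<le> X e \<omega>"
    and conv: "weakly_converges (\<lambda>n. cascade_approx l X n \<omega>) (m \<omega>)"
    and sets: "sets (m \<omega>) = sets (restrict_space borel {0..1})"
  shows "tree_limit l (\<lambda>e. X e \<omega>) = ennreal (total_mass m \<omega>)"
proof -
  have space_m: "space (m \<omega>) = {0..1}"
    using sets_eq_imp_space_eq[OF sets] by (simp add: space_restrict_space)
  have space_a: "space (cascade_approx l X n \<omega>) = {0..1}" for n
    unfolding cascade_approx_def by (simp add: space_restrict_space)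
  have "(\<lambda>n. \<integral>x. (1::real) \<partial>cascade_approx l X n \<omega>) \<longlonglongrightarrow> (\<integral>x. 1 \<partial>m \<omega>)"
    using conv unfolding weakly_converges_def by (elim allE[of _ "\<lambda>_. 1"]) auto
  then have "(\<lambda>n. measure (cascade_approx l X n \<omega>) {0..1}) \<longlonglongrightarrow> total_mass m \<omega>"
    by (simp add: space_m space_a total_mass_def)
  then have "(\<lambda>n. ennreal (measure (cascade_approx l X n \<omega>) {0..1})) \<longlonglongrightarrow> ennreal (total_mass m \<omega>)"
    by (rule tendsto_ennrealI)
  moreover have "ennreal (measure (cascade_approx l X n \<omega>) {0..1}) = tree_mass l n (\<lambda>e. X e \<omega>)" for n
    using emeasure_cascade_approx[where X = X and \<omega> = \<omega> and n = n, OF assms(1) nonneg]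
      tree_mass_finite[of l n "\<lambda>e. X e \<omega>"]
    by (simp add: emeasure_eq_ennreal_measure[symmetric] less_top)
  ultimately show ?thesis
    unfolding tree_limit_def by (intro lim_imp_Liminf) auto
qed

section \<open>Independence and self-similarity at the root\<close>

text \<open>
  The numbers \<open>0\<close> and \<open>1\<close> index the normalised weights of the first two children of the root, and
  \<open>2\<close> and \<open>3\<close> the limit masses of the subtrees below these children.  A single index set
  allows one independence statement for all four quantities.
\<close>

definition root_part :: "nat \<Rightarrow> nat \<Rightarrow> (nat list \<Rightarrow> real) \<Rightarrow> real" where
  "root_part l i x =
     (if i < 2 then x [i] / real l else enn2real (tree_limit l (\<lambda>e. x ((i - 2) # e))))"

context prob_space begin

text \<open>
  The four quantities are measurable functions of the weights on four disjoint sets of words: two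
  singletons and the proper descendants of these two words.
\<close>

lemma indep_vars_root_part:
  assumes indep: "indep_vars (\<lambda>_. borel) X (words l)" and "l \<ge> 2"
  shows "indep_vars (\<lambda>_. borel) (\<lambda>i \<omega>. root_part l i (\<lambda>e. X e \<omega>)) {..<4}"
proof -
  define I where "I i = (if i < 2 then {[i]} else (#) (i - 2) ` words l)" for i :: nat
  have I_words: "I i \<subseteq> words l" if "i < 4" for i
    using that \<open>l \<ge> 2\<close> by (auto simp: I_def singleton_in_words Cons_in_words)
  have disj: "disjoint_family_on I {..<4}"
    unfolding disjoint_family_on_def
  proof (intro ballI impI)
    fix i j :: nat
    assume "i \<in> {..<4}" "j \<in> {..<4}" "i \<noteq> j"
    then show "I i \<inter> I j = {}"
      by (cases "i < 2"; cases "j < 2") (auto simp: I_def Nil_notin_words)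
  qed
  have restr: "indep_vars (\<lambda>i. PiM (I i) (\<lambda>_. borel)) (\<lambda>i \<omega>. restrict (\<lambda>e. X e \<omega>) (I i)) {..<4}"
    by (rule indep_vars_restrict[OF indep I_words disj]) simp
  have meas: "root_part l i \<in> borel_measurable (PiM (I i) (\<lambda>_. borel))" for i
  proof (cases "i < 2")
    case True
    have "(\<lambda>x. x [i]) \<in> borel_measurable (PiM (I i) (\<lambda>_. borel :: real measure))"
      using True by (intro measurable_component_singleton) (simp add: I_def)
    then show ?thesis using True by (simp add: root_part_def[abs_def])
  next
    case False
    have eq: "tree_limit l (\<lambda>e. x ((i - 2) # e)) = tree_limit l (\<lambda>e\<in>words l. x ((i - 2) # e))" for x
      by (rule tree_limit_cong) simp
    have "(\<lambda>x. \<lambda>e\<in>words l. x ((i - 2) # e)) \<in>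
        PiM (I i) (\<lambda>_. borel) \<rightarrow>\<^sub>M PiM (words l) (\<lambda>_. borel :: real measure)"
      using False by (intro measurable_restrict measurable_component_singleton) (simp add: I_def)
    from measurable_compose[OF this measurable_tree_limit] show ?thesis
      using False by (simp add: root_part_def[abs_def] eq)
  qed
  have "indep_vars (\<lambda>_. borel) (\<lambda>i \<omega>. root_part l i (restrict (\<lambda>e. X e \<omega>) (I i))) {..<4}"
    by (rule indep_vars_compose2[OF restr meas])
  moreover have "root_part l i (restrict (\<lambda>e. X e \<omega>) (I i)) = root_part l i (\<lambda>e. X e \<omega>)" for i \<omega>
  proof (cases "i < 2")
    case True
    then show ?thesis by (simp add: root_part_def I_def)
  next
    case False
    then have "tree_limit l (\<lambda>e. restrict (\<lambda>e. X e \<omega>) (I i) ((i - 2) # e)) =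
        tree_limit l (\<lambda>e. X ((i - 2) # e) \<omega>)"
      by (intro tree_limit_cong) (simp add: I_def)
    with False show ?thesis by (simp add: root_part_def)
  qed
  ultimately show ?thesis by simp
qed

text \<open>
  The family of weights has a product law with equal factors, and prefixing a letter is an injection
  of the words into themselves; such a relabelling does not change the law of the family.
\<close>

lemma distr_tree_limit_subtree:
  assumes indep: "indep_vars (\<lambda>_. borel) X (words l)"
    and law: "\<And>e. e \<in> words l \<Longrightarrow> distr M borel (X e) = D"
    and "j < l"
  shows "distr M borel (\<lambda>\<omega>. tree_limit l (\<lambda>e. X (j # e) \<omega>)) =
      distr M borel (\<lambda>\<omega>. tree_limit l (\<lambda>e. X e \<omega>))"
proof -
  have root: "[j] \<in> words l" using \<open>j < l\<close> by (rule singleton_in_words)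
  have X[measurable]: "X e \<in> borel_measurable M" if "e \<in> words l" for e
    using indep that by (auto simp: indep_vars_def)
  have "prob_space D" unfolding law[OF root, symmetric] using X[OF root] by (rule prob_space_distr)
  have sets_D: "sets D = sets borel" unfolding law[OF root, symmetric] by simp
  let ?B = "PiM (words l) (\<lambda>_. borel :: real measure)" and ?D = "PiM (words l) (\<lambda>_. D)"
  let ?X = "\<lambda>\<omega>. \<lambda>e\<in>words l. X e \<omega>" and ?T = "\<lambda>x. \<lambda>e\<in>words l. x (j # e)"
  have sets_PiM_D: "sets ?D = sets ?B" by (intro sets_PiM_cong) (auto simp: sets_D)
  have X_meas: "?X \<in> M \<rightarrow>\<^sub>M ?B" by (intro measurable_restrict X)
  have T_meas: "?T \<in> ?B \<rightarrow>\<^sub>M ?B"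
    using \<open>j < l\<close> by (intro measurable_restrict measurable_component_singleton Cons_in_words)
  have "distr M ?B ?X = PiM (words l) (\<lambda>e. distr M borel (X e))"
    using root X indep by (subst indep_vars_iff_distr_eq_PiM'[symmetric]) auto
  also have "\<dots> = ?D" by (intro PiM_cong) (auto simp: law)
  finally have joint: "distr M ?B ?X = ?D" .
  have shift: "distr ?D ?B ?T = ?D"
  proof -
    have "distr ?D ?D ?T = ?D"
      using \<open>prob_space D\<close> \<open>j < l\<close>
      by (intro distr_PiM_reindex[of "words l" "\<lambda>_. D" "(#) j"]) (auto simp: Cons_in_words)
    then show ?thesis by (subst (asm) distr_cong[OF refl sets_PiM_D refl])
  qed
  have "(\<lambda>\<omega>. tree_limit l (\<lambda>e. X (j # e) \<omega>)) = (\<lambda>\<omega>. tree_limit l (?T (?X \<omega>)))"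
    using \<open>j < l\<close> by (intro ext tree_limit_cong) (auto simp: Cons_in_words)
  then have "distr M borel (\<lambda>\<omega>. tree_limit l (\<lambda>e. X (j # e) \<omega>)) =
      distr M borel (\<lambda>\<omega>. tree_limit l (?T (?X \<omega>)))"
    by (rule arg_cong)
  also have "\<dots> = distr (distr M ?B ?X) borel (\<lambda>x. tree_limit l (?T x))"
    using measurable_compose[OF T_meas measurable_tree_limit]
    by (subst distr_distr[OF _ X_meas]) (simp_all only: comp_def)
  also have "\<dots> = distr (distr (distr M ?B ?X) ?B ?T) borel (tree_limit l)"
    using T_meas
    by (subst distr_distr[OF measurable_tree_limit]) (simp_all only: comp_def measurable_distr_eq1)
  also have "\<dots> = distr (distr M ?B ?X) borel (tree_limit l)" by (simp only: joint shift)
  also have "\<dots> = distr M borel (\<lambda>\<omega>. tree_limit l (?X \<omega>))"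
    using X_meas by (simp add: distr_distr comp_def)
  also have "(\<lambda>\<omega>. tree_limit l (?X \<omega>)) = (\<lambda>\<omega>. tree_limit l (\<lambda>e. X e \<omega>))"
    by (intro ext tree_limit_cong) auto
  finally show ?thesis .
qed

lemma measurable_tree_limit_compose:
  assumes "\<And>e. e \<in> words l \<Longrightarrow> X e \<in> borel_measurable M"
  shows "(\<lambda>\<omega>. tree_limit l (\<lambda>e. X e \<omega>)) \<in> borel_measurable M"
proof -
  have "(\<lambda>\<omega>. \<lambda>e\<in>words l. X e \<omega>) \<in> M \<rightarrow>\<^sub>M PiM (words l) (\<lambda>_. borel)"
    by (intro measurable_restrict assms)
  from measurable_compose[OF this measurable_tree_limit]
  have "(\<lambda>\<omega>. tree_limit l (\<lambda>e\<in>words l. X e \<omega>)) \<in> borel_measurable M" .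
  also have "(\<lambda>\<omega>. tree_limit l (\<lambda>e\<in>words l. X e \<omega>)) = (\<lambda>\<omega>. tree_limit l (\<lambda>e. X e \<omega>))"
    by (intro ext tree_limit_cong) auto
  finally show ?thesis .
qed

lemma integrable_negative_powr_of_epow:
  assumes W[measurable]: "W \<in> borel_measurable M" and pos: "AE x in M. 0 < W x"
    and fin: "(\<integral>\<^sup>+ x. epow (W x) (- b) \<partial>M) < \<infinity>" and "c > 0"
  shows "integrable M (\<lambda>x. (W x / c) powr - b)"
proof (rule integrableI_bounded)
  have "(\<integral>\<^sup>+ x. ennreal (norm ((W x / c) powr - b)) \<partial>M) =
      (\<integral>\<^sup>+ x. ennreal (c powr b) * ennreal (W x powr - b) \<partial>M)"
    using pos \<open>c > 0\<close>
    by (intro nn_integral_cong_AE)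
      (auto elim!: eventually_mono simp: powr_divide powr_minus_divide ennreal_mult[symmetric])
  also have "\<dots> = ennreal (c powr b) * (\<integral>\<^sup>+ x. ennreal (W x powr - b) \<partial>M)"
    by (rule nn_integral_cmult) simp
  also have "(\<integral>\<^sup>+ x. ennreal (W x powr - b) \<partial>M) = (\<integral>\<^sup>+ x. epow (W x) (- b) \<partial>M)"
    using pos by (intro nn_integral_cong_AE) (auto elim!: eventually_mono simp: epow_def)
  also have "ennreal (c powr b) * \<dots> < \<infinity>" using fin by (simp add: ennreal_mult_less_top)
  finally show "(\<integral>\<^sup>+ x. ennreal (norm ((W x / c) powr - b)) \<partial>M) < \<infinity>" .
qed simp

end

section \<open>Negative moments of the cascade\<close>

theorem proposition5:
  fixes l :: nat
    and P :: "'b measure" and W :: "'b \<Rightarrow> real"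
    and M :: "'a measure" and X :: "nat list \<Rightarrow> 'a \<Rightarrow> real"
    and m :: "'a \<Rightarrow> real measure"
    and \<alpha> :: real
  assumes "l \<ge> 2"
    and "prob_space P"
    and "W \<in> borel_measurable P"
    and "AE x in P. 0 \<le> W x"
    and "integrable P W" and "prob_space.expectation P W = 1"
    and "prob_space M"
    and "independent_copies P W M (words l) X"
    and "prob_space.prob P {x \<in> space P. W x = 0} = 0"
    and "\<And>q::real. (\<integral>\<^sup>+ x. epow (W x) q \<partial>P) < \<infinity>"
    and "mandelbrot_cascade l M X m"
    and "nondegenerate M m"
    and "\<alpha> > 0"
  shows "(\<integral>\<^sup>+ \<omega>. epow (total_mass m \<omega>) (- \<alpha>) \<partial>M) < \<infinity>"
proof -
  interpret P: prob_space P by fact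
  interpret M: prob_space M by fact
  note W[measurable] = \<open>W \<in> borel_measurable P\<close>
  have indep: "M.indep_vars (\<lambda>_. borel) X (words l)"
    and law: "\<And>e. e \<in> words l \<Longrightarrow> distr M borel (X e) = distr P borel W"
    using \<open>independent_copies P W M (words l) X\<close> unfolding independent_copies_def by auto
  have X[measurable]: "X e \<in> borel_measurable M" if "e \<in> words l" for e
    using indep that by (auto simp: M.indep_vars_def)
  have "AE x in P. x \<notin> {x \<in> space P. W x = 0}"
    using \<open>P.prob {x \<in> space P. W x = 0} = 0\<close> by (subst P.prob_eq_0[symmetric]) auto
  with \<open>AE x in P. 0 \<le> W x\<close> AE_space have W_pos: "AE x in P. 0 < W x"
    by eventually_elim auto
  have X_pos: "AE \<omega> in M. 0 < X e \<omega>" if "e \<in> words l" for e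
  proof -
    have "AE y in distr P borel W. 0 < y" using W_pos by (subst AE_distr_iff) auto
    then have "AE y in distr M borel (X e). 0 < y" by (simp only: law[OF that])
    then show ?thesis using X[OF that] by (subst (asm) AE_distr_iff) auto
  qed
  have X_pos_all: "AE \<omega> in M. \<forall>e\<in>words l. 0 < X e \<omega>"
    using X_pos by (simp add: AE_ball_countable)
  have X_moment: "integrable M (\<lambda>\<omega>. (X e \<omega> / real l) powr - (\<alpha> / 2))" if "e \<in> words l" for e
  proof -
    have "integrable P (\<lambda>x. (W x / real l) powr - (\<alpha> / 2))"
      using W W_pos assms(10) \<open>l \<ge> 2\<close> by (intro P.integrable_negative_powr_of_epow) auto
    then have "integrable (distr P borel W) (\<lambda>y. (y / real l) powr - (\<alpha> / 2))"
      by (subst integrable_distr_eq) auto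
    then have "integrable (distr M borel (X e)) (\<lambda>y. (y / real l) powr - (\<alpha> / 2))"
      by (simp only: law[OF that])
    then show ?thesis using X[OF that] by (subst (asm) integrable_distr_eq) auto
  qed

  let ?L = "\<lambda>\<omega>. tree_limit l (\<lambda>e. X e \<omega>)"
  have L_meas[measurable]: "?L \<in> borel_measurable M"
    using X by (rule M.measurable_tree_limit_compose)
  have sub_meas[measurable]: "(\<lambda>\<omega>. tree_limit l (\<lambda>e. X (j # e) \<omega>)) \<in> borel_measurable M" if "j < l" for j
    using that by (intro M.measurable_tree_limit_compose X Cons_in_words)
  have L_total: "AE \<omega> in M. ?L \<omega> = ennreal (total_mass m \<omega>)"
  proof -
    have "AE \<omega> in M. weakly_converges (\<lambda>n. cascade_approx l X n \<omega>) (m \<omega>)"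
      and sets_m: "\<And>\<omega>. \<omega> \<in> space M \<Longrightarrow> sets (m \<omega>) = sets (restrict_space borel {0..1})"
      using \<open>mandelbrot_cascade l M X m\<close>
      unfolding mandelbrot_cascade_def finite_random_measure_def by auto
    from this(1) X_pos_all AE_space show ?thesis
    proof eventually_elim
      case (elim \<omega>)
      with \<open>l \<ge> 2\<close> sets_m show ?case by (intro tree_limit_eq_total_mass) (auto simp: less_imp_le)
    qed
  qed
  have sub_law: "distr M borel (\<lambda>\<omega>. tree_limit l (\<lambda>e. X (j # e) \<omega>)) = distr M borel ?L"
    if "j < l" for j
    using indep law that by (rule M.distr_tree_limit_subtree)
  have sub_finite: "AE \<omega> in M. tree_limit l (\<lambda>e. X (j # e) \<omega>) < \<top>" if "j < l" for j
  proof -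
    have "AE y in distr M borel ?L. y < \<top>"
      using L_total by (subst AE_distr_iff) (auto elim!: eventually_mono)
    then have "AE y in distr M borel (\<lambda>\<omega>. tree_limit l (\<lambda>e. X (j # e) \<omega>)). y < \<top>"
      by (simp only: sub_law[OF that])
    then show ?thesis using sub_meas[OF that] by (subst (asm) AE_distr_iff) auto
  qed

  \<comment> \<open>A version of the total mass that is a measurable function of the weights; the infinite values
    that are mapped to 0 occur on null sets only.\<close>
  define Y where "Y \<omega> = enn2real (?L \<omega>)" for \<omega>
  define V where "V i \<omega> = root_part l i (\<lambda>e. X e \<omega>)" for i \<omega>
  have Y_total: "AE \<omega> in M. Y \<omega> = total_mass m \<omega>"
    using L_total by eventually_elim (simp add: Y_def total_mass_def)
  have branch: "AE \<omega> in M. X [j] \<omega> / real l * enn2real (tree_limit l (\<lambda>e. X (j # e) \<omega>)) \<le> Y \<omega>"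
    if "j < l" for j
    using L_total sub_finite[OF that] X_pos[OF singleton_in_words[OF that]]
  proof eventually_elim
    case (elim \<omega>)
    have "enn2real (ennreal (1 / real l) * ennreal (X [j] \<omega>) * tree_limit l (\<lambda>e. X (j # e) \<omega>)) \<le> Y \<omega>"
      unfolding Y_def using elim(1) tree_limit_ge_subtree[OF that, of "\<lambda>e. X e \<omega>"]
      by (intro enn2real_mono) auto
    then show ?case using elim(3) by (simp add: enn2real_mult)
  qed
  have "(\<integral>\<^sup>+ \<omega>. epow (Y \<omega>) (- \<alpha>) \<partial>M) < \<infinity>"
  proof (rule M.negative_moment_of_smoothing_inequality)
    show "M.indep_vars (\<lambda>_. borel) V {..<4}"
      unfolding V_def[abs_def] using indep \<open>l \<ge> 2\<close> by (rule M.indep_vars_root_part)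
    show "distr M borel (V i) = distr M borel Y" if "i \<in> {2, 3}" for i
    proof -
      have "i - 2 < l" using that \<open>l \<ge> 2\<close> by auto
      have "distr M borel (V i) =
          distr (distr M borel (\<lambda>\<omega>. tree_limit l (\<lambda>e. X ((i - 2) # e) \<omega>))) borel enn2real"
        using that sub_meas[OF \<open>i - 2 < l\<close>]
        by (subst distr_distr) (auto simp: V_def[abs_def] root_part_def comp_def)
      also have "\<dots> = distr (distr M borel ?L) borel enn2real"
        by (simp only: sub_law[OF \<open>i - 2 < l\<close>])
      also have "\<dots> = distr M borel Y"
        by (subst distr_distr) (auto simp: Y_def[abs_def] comp_def)
      finally show ?thesis .
    qed
    show "Y \<in> borel_measurable M" unfolding Y_def by measurable
    show "AE \<omega> in M. 0 < V 0 \<omega> \<and> 0 < V 1 \<omega>"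
      using X_pos_all
      by eventually_elim (use \<open>l \<ge> 2\<close> in \<open>auto simp: V_def root_part_def singleton_in_words\<close>)
    show "AE \<omega> in M. 0 \<le> Y \<omega>" by (simp add: Y_def)
    have "0 < l" "1 < l" using \<open>l \<ge> 2\<close> by auto
    from branch[OF this(1)] branch[OF this(2)]
    show "AE \<omega> in M. V 0 \<omega> * V 2 \<omega> \<le> Y \<omega> \<and> V 1 \<omega> * V 3 \<omega> \<le> Y \<omega>"
      by eventually_elim (simp add: V_def root_part_def)
    show "integrable M (\<lambda>\<omega>. V i \<omega> powr - (\<alpha> / 2))" if "i < 2" for i
      using X_moment[of "[i]"] that \<open>l \<ge> 2\<close> by (simp add: V_def root_part_def singleton_in_words)
    show "\<not> (AE \<omega> in M. Y \<omega> = 0)"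
    proof
      assume "AE \<omega> in M. Y \<omega> = 0"
      with Y_total have "AE \<omega> in M. total_mass m \<omega> = 0" by eventually_elim simp
      with \<open>nondegenerate M m\<close> show False unfolding nondegenerate_def by simp
    qed
  qed fact
  also have "(\<integral>\<^sup>+ \<omega>. epow (Y \<omega>) (- \<alpha>) \<partial>M) = (\<integral>\<^sup>+ \<omega>. epow (total_mass m \<omega>) (- \<alpha>) \<partial>M)"
    using Y_total by (intro nn_integral_cong_AE) (auto elim!: eventually_mono)
  finally show ?thesis .
qed

end
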